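(* Let $\alpha>0$, $n\in\mathbb N=\{1,2,\dots\}$, $0<a<b$, let $x:[a,b]\to\mathbb R$ be a function of class $C^{n+1}$, and let $N\ge n+1$ be an integer. Consider the approximation $$ {_t\mathcal{I}_b^\alpha} x(t)\approx\sum_{i=0}^{n}A_i(\alpha,N)\left(\ln\frac{b}{t}\right)^{\alpha+i} x_{i,0}(t)+\sum_{p=n+1}^N B(\alpha,p)\left(\ln\frac{b}{t}\right)^{\alpha+n-p}W_p(t), $$ where $$ A_i(\alpha,N)=\frac{(-1)^i}{\Gamma(\alpha+i+1)}\left[1+\sum_{p=n-i+1}^N\frac{\Gamma(p-\alpha-n)}{\Gamma(-\alpha-i)(p-n+i)!}\right],\quad B(\alpha,p)=\frac{\Gamma(p-\alpha-n)}{\Gamma(\alpha)\Gamma(1-\alpha)(p-n)!}, $$ $$ W_p(t)=\int_t^b (p-n)\left(\ln\frac{b}{\tau}\right)^{p-n-1}\frac{x(\tau)}{\tau}\,d\tau . $$ Then the error $E_{tr}(t)$ (the left-hand side minus the right-hand side of the approximation) satisfies, for every $t\in\,]a,b[$, $$ \left| E_{tr}(t)\right|\leq L_n(t)\,\frac{e^{(\alpha+n)^2+\alpha+n}}{\Gamma(\alpha+n+1)(\alpha+n)N^{\alpha+n}}\left(\ln\frac{b}{t}\right)^{\alpha+n}(b-t),\qquad L_n(t)=\max_{\tau\in[t,b]}|x_{n,1}(\tau)|. $$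
   Context: For $0<a<b$, $\alpha>0$ and integrable $x:[a,b]\to\mathbb R$, the right Hadamard fractional integral of order $\alpha$ is $$ {_t\mathcal{I}_b^\alpha} x(t)=\frac{1}{\Gamma(\alpha)}\int_t^b\left(\ln\frac{\tau}{t}\right)^{\alpha-1}\frac{x(\tau)}{\tau}\,d\tau,\quad t\in\,]a,b[. $$ The functions $x_{k,0}$ and $x_{k,1}$ are defined recursively for $k\ge 0$ by $x_{0,0}(t)=x(t)$, $x_{k+1,0}(t)=t\frac{d}{dt}x_{k,0}(t)$, and $x_{0,1}(t)=\dot x(t)$, $x_{k+1,1}(t)=\frac{d}{dt}\bigl(t\,x_{k,1}(t)\bigr)$. Convention on Gamma quotients (needed only when $\alpha$ is an integer, where the Gamma function has poles): $\frac{\Gamma(p-\alpha-n)}{\Gamma(-\alpha-i)}$ means $\prod_{j=0}^{p-n+i-1}(-\alpha-i+j)$, and $\frac{\Gamma(p-\alpha-n)}{\Gamma(1-\alpha)}$ means $\prod_{j=1}^{p-n-1}(j-\alpha)$ (an empty product being $1$); for non-integer $\alpha$ these are identities. *)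

theory Defs
  imports "HOL-Analysis.Analysis"
begin

text \<open>Derivatives of functions on the closed interval \<open>[a,b]\<close> are taken relative to that
  interval, i.e. they are one-sided at the end points.\<close>

definition deriv_on :: "real \<Rightarrow> real \<Rightarrow> (real \<Rightarrow> real) \<Rightarrow> real \<Rightarrow> real" where
  "deriv_on a b f t = vector_derivative f (at t within {a..b})"

fun Ck_on :: "nat \<Rightarrow> real \<Rightarrow> real \<Rightarrow> (real \<Rightarrow> real) \<Rightarrow> bool" where
  "Ck_on 0 a b f \<longleftrightarrow> continuous_on {a..b} f"
| "Ck_on (Suc k) a b f \<longleftrightarrow> f differentiable_on {a..b} \<and> Ck_on k a b (deriv_on a b f)"

fun x0 :: "real \<Rightarrow> real \<Rightarrow> (real \<Rightarrow> real) \<Rightarrow> nat \<Rightarrow> real \<Rightarrow> real" where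
  "x0 a b x 0 = x"
| "x0 a b x (Suc k) = (\<lambda>t. t * deriv_on a b (x0 a b x k) t)"

fun x1 :: "real \<Rightarrow> real \<Rightarrow> (real \<Rightarrow> real) \<Rightarrow> nat \<Rightarrow> real \<Rightarrow> real" where
  "x1 a b x 0 = deriv_on a b x"
| "x1 a b x (Suc k) = deriv_on a b (\<lambda>t. t * x1 a b x k t)"

definition right_Hadamard_integral :: "real \<Rightarrow> real \<Rightarrow> (real \<Rightarrow> real) \<Rightarrow> real \<Rightarrow> real" where
  "right_Hadamard_integral b \<alpha> x t =
     1 / Gamma \<alpha> * (LINT \<tau>:{t..b}|lebesgue. ln (\<tau> / t) powr (\<alpha> - 1) * (x \<tau> / \<tau>))"

text \<open>The Gamma quotients \<open>\<Gamma>(p-\<alpha>-n)/\<Gamma>(-\<alpha>-i)\<close> and \<open>\<Gamma>(p-\<alpha>-n)/\<Gamma>(1-\<alpha>)\<close>. For integer \<open>\<alpha>\<close> the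
  denominators are poles (where the library sets Gamma to 0), and the quotients denote
  finite products. They are only used for \<open>p + i > n\<close> and \<open>p > n\<close> respectively, so that the
  natural-number subtractions do not truncate.\<close>

definition Gamma_quot_A :: "real \<Rightarrow> nat \<Rightarrow> nat \<Rightarrow> nat \<Rightarrow> real" where
  "Gamma_quot_A \<alpha> n i p =
     (if \<alpha> \<in> \<int> then (\<Prod>j<p + i - n. - \<alpha> - real i + real j)
      else Gamma (real p - \<alpha> - real n) / Gamma (- \<alpha> - real i))"

definition Gamma_quot_B :: "real \<Rightarrow> nat \<Rightarrow> nat \<Rightarrow> real" where
  "Gamma_quot_B \<alpha> n p =
     (if \<alpha> \<in> \<int> then (\<Prod>j=1..p - n - 1. real j - \<alpha>)
      else Gamma (real p - \<alpha> - real n) / Gamma (1 - \<alpha>))"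

definition A_coeff :: "real \<Rightarrow> nat \<Rightarrow> nat \<Rightarrow> nat \<Rightarrow> real" where
  "A_coeff \<alpha> n N i =
     (-1) ^ i / Gamma (\<alpha> + real i + 1) *
       (1 + (\<Sum>p=n - i + 1..N. Gamma_quot_A \<alpha> n i p / fact (p + i - n)))"

definition B_coeff :: "real \<Rightarrow> nat \<Rightarrow> nat \<Rightarrow> real" where
  "B_coeff \<alpha> n p = Gamma_quot_B \<alpha> n p / (Gamma \<alpha> * fact (p - n))"

definition W :: "real \<Rightarrow> (real \<Rightarrow> real) \<Rightarrow> nat \<Rightarrow> nat \<Rightarrow> real \<Rightarrow> real" where
  "W b x n p t =
     (LINT \<tau>:{t..b}|lebesgue. real (p - n) * ln (b / \<tau>) ^ (p - n - 1) * (x \<tau> / \<tau>))"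

definition Hadamard_approx ::
  "real \<Rightarrow> real \<Rightarrow> real \<Rightarrow> nat \<Rightarrow> nat \<Rightarrow> (real \<Rightarrow> real) \<Rightarrow> real \<Rightarrow> real" where
  "Hadamard_approx a b \<alpha> n N x t =
     (\<Sum>i=0..n. A_coeff \<alpha> n N i * ln (b / t) powr (\<alpha> + real i) * x0 a b x i t) +
     (\<Sum>p=n + 1..N. B_coeff \<alpha> n p * ln (b / t) powr (\<alpha> + real n - real p) * W b x n p t)"

definition E_tr ::
  "real \<Rightarrow> real \<Rightarrow> real \<Rightarrow> nat \<Rightarrow> nat \<Rightarrow> (real \<Rightarrow> real) \<Rightarrow> real \<Rightarrow> real" where
  "E_tr a b \<alpha> n N x t = right_Hadamard_integral b \<alpha> x t - Hadamard_approx a b \<alpha> n N x t"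

definition L_max :: "real \<Rightarrow> real \<Rightarrow> (real \<Rightarrow> real) \<Rightarrow> nat \<Rightarrow> real \<Rightarrow> real" where
  "L_max a b x n t = (GREATEST y. y \<in> (\<lambda>\<tau>. \<bar>x1 a b x n \<tau>\<bar>) ` {t..b})"

end

theory Submission
  imports Defs
begin

text \<open>In the variable \<open>z = ln (b / \<tau>) / ln (b / t)\<close> the Hadamard kernel is a multiple of
  \<open>(1 - z) powr (\<alpha> - 1)\<close>. Let \<open>R c M\<close> be the remainder of \<open>(1 - z) powr c\<close> after its binomial
  Taylor polynomial of degree \<open>M\<close>. The moments \<open>W\<close> account for the Taylor polynomial of degree
  \<open>N - n - 1\<close>, so the Hadamard integral minus the moment terms is an integral of \<open>x\<close>
  against \<open>R (\<alpha> - 1) (N - n - 1)\<close>. Since \<open>R c (M + 1)\<close> has derivative \<open>- c R (c - 1) M\<close> and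
  vanishes at 0, integrating by parts \<open>n + 1\<close> times produces exactly the terms with \<open>A_coeff\<close> and
  leaves an integral of \<open>x1 a b x n\<close> against \<open>R (\<alpha> + n) N\<close>. That remainder is bounded by the tail
  of the absolute binomial coefficients, which satisfy
  \<open>\<bar>c gchoose p\<bar> \<le> exp (c\<^sup>2 + c) p powr (- c - 1)\<close>.\<close>

section \<open>Bounds on generalized binomial coefficients\<close>

lemma powr_Bernoulli:
  fixes u c :: real
  assumes "0 < u" "1 \<le> c"
  shows "1 + c * (u - 1) \<le> u powr c"
proof -
  \<comment> \<open>Weighted AM-GM for \<open>u powr c\<close> and \<open>1\<close> with weights
    \<open>1 / c\<close> and \<open>1 - 1 / c\<close>; the left side is \<open>u\<close>.\<close>
  have "(u powr c) powr (1 / c) * 1 powr (1 - 1 / c) \<le> 1 / c * u powr c + (1 - 1 / c) * 1"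
    using assms by (intro Youngs_inequality_0) auto
  then have "u \<le> 1 / c * u powr c + (1 - 1 / c)"
    using assms by (simp add: powr_powr)
  then have "c * u \<le> c * (1 / c * u powr c + (1 - 1 / c))"
    using assms by (intro mult_left_mono) auto
  also have "\<dots> = u powr c + c - 1"
    using assms by (simp add: field_simps)
  finally show ?thesis
    by (simp add: algebra_simps)
qed

text \<open>By Bernoulli's inequality, \<open>\<bar>c gchoose p\<bar> * real p powr (c + 1)\<close> is decreasing in \<open>p\<close>.\<close>
lemma abs_gbinomial_le_small:
  fixes c :: real
  assumes c: "0 < c" "c \<le> 1" and p: "1 \<le> p"
  shows "\<bar>c gchoose p\<bar> \<le> c * real p powr (- c - 1)"
  using p
proof (induction p rule: dec_induct)
  case base
  then show ?case using c by simp
next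
  case (step p)
  define u where "u = real p / real (Suc p)"
  have u: "0 < u" "u < 1" using step by (auto simp: u_def)
  have "c gchoose Suc p = (c gchoose p) * ((c - real p) / real (Suc p))"
    using gbinomial_absorb_comp[of c p] gbinomial_absorption[of p c]
    by (simp add: field_simps del: of_nat_Suc)
  \<comment> \<open>Since \<open>c\<close> \<le> 1 \<le> \<open>p\<close>, the factor
    \<open>c - real p\<close> is not positive, which fixes its absolute value.\<close>
  then have "\<bar>c gchoose Suc p\<bar> = \<bar>c gchoose p\<bar> * ((real p - c) / real (Suc p))"
    using c step by (simp add: abs_mult)
  also have "(real p - c) / real (Suc p) = 1 + (c + 1) * (u - 1)"
    by (simp add: u_def field_simps)
  also have "\<dots> \<le> u powr (c + 1)"
    using c u by (intro powr_Bernoulli) auto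
  finally have "\<bar>c gchoose Suc p\<bar> \<le> \<bar>c gchoose p\<bar> * u powr (c + 1)"
    by (simp add: mult_left_mono)
  also have "\<dots> \<le> c * real p powr (- c - 1) * u powr (c + 1)"
    by (intro mult_right_mono step.IH) auto
  also have "real p powr (- c - 1) = inverse (real p powr (c + 1))"
    by (simp flip: powr_minus)
  also have "c * inverse (real p powr (c + 1)) * u powr (c + 1) = c * inverse (real (Suc p) powr (c + 1))"
    using step by (simp add: u_def powr_divide field_simps del: of_nat_Suc)
  also have "inverse (real (Suc p) powr (c + 1)) = real (Suc p) powr (- c - 1)"
    by (simp flip: powr_minus)
  finally show ?case .
qed

text \<open>Absorption, \<open>c gchoose p = c / p * ((c - 1) gchoose (p - 1))\<close>, lowers
  \<open>c\<close> by one until \<open>c\<close> \<le> 1. One reduction costs at most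
  \<open>exp (c - 1) * exp c\<close>, and
  \<open>(c - 1)\<^sup>2 + (c - 1) + (c - 1) + c = c\<^sup>2 + c - 1\<close>, so a quadratic
  exponent absorbs all the costs.\<close>

lemma abs_gbinomial_le:
  fixes c :: real
  assumes "0 < c" "1 \<le> p"
  shows "\<bar>c gchoose p\<bar> \<le> exp (c\<^sup>2 + c) * real p powr (- c - 1)"
proof -
  have aux: "\<bar>c gchoose p\<bar> \<le> exp (c\<^sup>2 + c) * real p powr (- c - 1)"
    if "0 < c" "c \<le> real m + 1" "1 \<le> p" for m p c
    using that
  proof (induction m arbitrary: c p)
    case 0
    have "c \<le> exp (c\<^sup>2 + c)"
      using exp_ge_add_one_self[of "c\<^sup>2 + c"] zero_le_power2[of c] by linarith
    then have "c * real p powr (- c - 1) \<le> exp (c\<^sup>2 + c) * real p powr (- c - 1)"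
      by (intro mult_right_mono) auto
    then show ?case
      using abs_gbinomial_le_small[of c p] 0 by linarith
  next
    case (Suc m)
    have c_le: "c \<le> exp (c - 1)" using exp_ge_add_one_self[of "c - 1"] by linarith
    \<comment> \<open>\<open>p = 1\<close> is separate because the induction hypothesis is applied
      at \<open>p - 1\<close>, which must be at least 1.\<close>
    consider "c \<le> real m + 1" | "c > real m + 1" "p = 1" | "c > real m + 1" "p > 1"
      using Suc.prems by linarith
    then show ?case
    proof cases
      case 1
      then show ?thesis using Suc by blast
    next
      case 2
      have "c \<le> exp (c\<^sup>2 + c)"
        using exp_ge_add_one_self[of "c\<^sup>2 + c"] zero_le_power2[of c] by linarith
      then show ?thesis using 2 Suc.prems by simp
    next
      case 3
      define k where "k = p - 1"
      have k: "p = Suc k" "k \<ge> 1" using 3 by (auto simp: k_def)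
      have "\<bar>c gchoose p\<bar> = c / p * \<bar>(c - 1) gchoose k\<bar>"
        using gbinomial_absorption'[of p c] 3 Suc.prems by (simp add: abs_mult k)
      also have "\<dots> \<le> c / p * (exp ((c - 1)\<^sup>2 + (c - 1)) * real k powr (- (c - 1) - 1))"
        using Suc.prems 3 k by (intro mult_left_mono Suc.IH) auto
      also have "\<dots> = c * exp (c\<^sup>2 - c) * (real p / real k) powr c * real p powr (- c - 1)"
      proof -
        have "real p powr (- c - 1) = inverse (real p powr c) / real p"
          using k by (subst powr_diff) (simp add: powr_minus)
        then show ?thesis
          using k by (simp add: powr_divide powr_minus field_simps power2_eq_square del: of_nat_Suc)
      qed
      also have "\<dots> \<le> exp (c - 1) * exp (c\<^sup>2 - c) * exp c * real p powr (- c - 1)"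
      proof -
        \<comment> \<open>\<open>p / k = 1 + 1 / k\<close> \<le> 2 \<le>
          \<open>exp 1\<close>.\<close>
        have "(real p / real k) powr c \<le> exp 1 powr c"
          using k Suc.prems exp_ge_add_one_self[of 1]
          by (intro powr_mono2) (auto simp: field_simps intro: order_trans[of _ "real k * 2"])
        then have "(real p / real k) powr c \<le> exp c"
          by (simp add: powr_def)
        then show ?thesis
          using c_le Suc.prems by (intro mult_mono mult_right_mono) auto
      qed
      also have "\<dots> = exp (c\<^sup>2 + c - 1) * real p powr (- c - 1)"
        by (simp flip: exp_add)
      also have "\<dots> \<le> exp (c\<^sup>2 + c) * real p powr (- c - 1)"
        by (intro mult_right_mono) auto
      finally show ?thesis .
    qed
  qed
  obtain m :: nat where "c \<le> real m" using real_arch_simple by blast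
  then show ?thesis using aux[of c m p] assms by simp
qed

text \<open>Integral comparison: the right side is the integral over \<open>{q - 1..q}\<close> of
  the decreasing function \<open>c * y powr (- c - 1)\<close>. It makes the coefficient bounds
  telescope. The proof needs only \<open>1 + c / q\<close> \<le>
  \<open>(1 - 1 / q) powr (- c)\<close>.\<close>

lemma powr_telescope_bound:
  fixes c q :: real
  assumes "0 < c" "1 < q"
  shows "c * q powr (- c - 1) \<le> (q - 1) powr (- c) - q powr (- c)"
proof -
  define u where "u = 1 - 1 / q"
  have u: "0 < u" using assms by (simp add: u_def)
  have "1 + c / q = 1 - c * (u - 1)" by (simp add: u_def)
  also have "\<dots> \<le> 1 - c * ln u"
    using ln_le_minus_one[OF u] assms by (simp add: mult_left_mono)
  also have "\<dots> \<le> exp (- c * ln u)"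
    using exp_ge_add_one_self[of "- c * ln u"] by linarith
  also have "\<dots> = u powr (- c)" using u by (simp add: powr_def)
  finally have "(1 + c / q) * q powr (- c) \<le> u powr (- c) * q powr (- c)"
    by (intro mult_right_mono) auto
  also have "u powr (- c) * q powr (- c) = (u * q) powr (- c)"
    using u assms by (simp add: powr_mult)
  also have "u * q = q - 1" using assms by (simp add: u_def field_simps)
  finally show ?thesis
    using assms by (simp add: powr_diff field_simps)
qed

section \<open>The remainder of the binomial series\<close>

definition binomial_remainder :: "real \<Rightarrow> nat \<Rightarrow> real \<Rightarrow> real" where
  "binomial_remainder c M z = (1 - z) powr c - (\<Sum>q\<le>M. (c gchoose q) * (- z) ^ q)"

text \<open>For \<open>z < 1\<close> the binomial series converges to the power, so the remainder is
  the tail of the series. Its terms are dominated by telescoping differences of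
  \<open>K * real q powr (- c)\<close>, uniformly in \<open>z\<close>.\<close>

lemma binomial_remainder_bound:
  assumes c: "0 < c" and z: "0 \<le> z" "z < 1" and N: "1 \<le> N"
  shows "\<bar>binomial_remainder c N z\<bar> \<le> exp (c\<^sup>2 + c) / (c * real N powr c)"
proof -
  define K where "K = exp (c\<^sup>2 + c) / c"
  have K: "K > 0" using c by (simp add: K_def)
  let ?s = "\<lambda>M. \<Sum>q<M. (c gchoose q) * (- z) ^ q"
  \<comment> \<open>\<open>?s (Suc N)\<close> is the Taylor polynomial of degree \<open>N\<close>.
    The subtracted power makes the induction close and is dropped before the limit.\<close>
  have fin: "\<bar>?s (Suc N + k) - ?s (Suc N)\<bar> \<le> K * (real N powr (- c) - real (N + k) powr (- c))" for k
  proof (induction k)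
    case (Suc k)
    let ?q = "Suc (N + k)"
    have "\<bar>(c gchoose ?q) * (- z) ^ ?q\<bar> \<le> \<bar>c gchoose ?q\<bar> * 1"
      unfolding abs_mult power_abs using z
      by (intro mult_left_mono power_le_one) auto
    also have "\<dots> \<le> exp (c\<^sup>2 + c) * real ?q powr (- c - 1)"
      using abs_gbinomial_le[of c ?q] c by simp
    also have "\<dots> = K * (c * real ?q powr (- c - 1))"
      using c by (simp add: K_def)
    also have "\<dots> \<le> K * ((real ?q - 1) powr (- c) - real ?q powr (- c))"
      using K c N by (intro mult_left_mono powr_telescope_bound) auto
    finally have "\<bar>(c gchoose ?q) * (- z) ^ ?q\<bar> \<le> K * (real (N + k) powr (- c) - real ?q powr (- c))"
      by (simp add: algebra_simps)
    moreover have "?s (Suc N + Suc k) = ?s (Suc N + k) + (c gchoose ?q) * (- z) ^ ?q"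
      by simp
    ultimately show ?case using Suc by (simp add: algebra_simps del: power_Suc sum.lessThan_Suc)
  qed simp
  have "(\<lambda>q. (c gchoose q) * (- z) ^ q) sums (1 - z) powr c"
    using gen_binomial_real[of "- z" c] z by simp
  then have "?s \<longlonglongrightarrow> (1 - z) powr c" by (simp add: sums_def)
  then have "(\<lambda>k. ?s (Suc N + k)) \<longlonglongrightarrow> (1 - z) powr c"
    by (subst add.commute) (rule LIMSEQ_ignore_initial_segment)
  then have "(\<lambda>k. \<bar>?s (Suc N + k) - ?s (Suc N)\<bar>) \<longlonglongrightarrow> \<bar>(1 - z) powr c - ?s (Suc N)\<bar>"
    by (intro tendsto_intros)
  moreover have "\<bar>?s (Suc N + k) - ?s (Suc N)\<bar> \<le> K * real N powr (- c)" for k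
  proof -
    have "K * (real N powr (- c) - real (N + k) powr (- c)) \<le> K * real N powr (- c)"
      using K by simp
    then show ?thesis using fin[of k] by linarith
  qed
  ultimately have "\<bar>(1 - z) powr c - ?s (Suc N)\<bar> \<le> K * real N powr (- c)"
    by (intro LIMSEQ_le_const2) auto
  then show ?thesis
    by (simp add: binomial_remainder_def lessThan_Suc_atMost K_def powr_minus field_simps)
qed

text \<open>Termwise differentiation and absorption lower exponent and degree together, so repeated
  integration by parts stays within this family.\<close>

lemma has_real_derivative_binomial_remainder:
  assumes "z < 1"
  shows "(binomial_remainder c (Suc M) has_real_derivative
           - c * binomial_remainder (c - 1) M z) (at z)"
proof -
  let ?d = "\<lambda>q. (c gchoose q) * (real q * (- z) ^ (q - 1) * - 1)"
  have "(binomial_remainder c (Suc M) has_real_derivative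
          - c * (1 - z) powr (c - 1) - (\<Sum>q\<le>Suc M. ?d q)) (at z)"
    unfolding binomial_remainder_def using assms
    by (auto intro!: derivative_eq_intros sum.cong simp: algebra_simps simp del: sum.atMost_Suc)
  also have "(\<Sum>q\<le>Suc M. ?d q) = (\<Sum>q\<le>M. ?d (Suc q))"
    by (subst sum.atMost_Suc_shift) simp
  also have "\<dots> = (\<Sum>q\<le>M. - c * (((c - 1) gchoose q) * (- z) ^ q))"
  proof (rule sum.cong)
    fix q
    have "?d (Suc q) = - ((real (Suc q) * (c gchoose Suc q)) * (- z) ^ q)"
      by (simp add: algebra_simps)
    then show "?d (Suc q) = - c * (((c - 1) gchoose q) * (- z) ^ q)"
      by (simp only: gbinomial_absorption mult_minus_left mult.assoc)
  qed simp
  also have "- c * (1 - z) powr (c - 1) - (\<Sum>q\<le>M. - c * (((c - 1) gchoose q) * (- z) ^ q))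
      = - c * binomial_remainder (c - 1) M z"
    unfolding binomial_remainder_def by (simp add: sum_distrib_left algebra_simps sum_negf)
  finally show ?thesis .
qed

lemma binomial_remainder_0 [simp]: "binomial_remainder c M 0 = 0"
  by (simp add: binomial_remainder_def power_0_left if_distrib[of "\<lambda>x. _ * x"] cong: if_cong)

text \<open>For positive exponents continuity extends to \<open>z = 1\<close>, which corresponds to
  the end point \<open>s = t\<close> of the integrals.\<close>

lemma continuous_on_binomial_remainder:
  assumes "0 < c"
  shows "continuous_on {..1} (binomial_remainder c M)"
  unfolding binomial_remainder_def using assms
  by (auto intro!: continuous_intros continuous_on_powr')

section \<open>Derivatives relative to \<open>{a..b}\<close> and the functions \<open>x0\<close> and
  \<open>x1\<close>\<close>

lemma deriv_on_has_vector_derivative: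
  assumes "f differentiable_on {a..b}" "t \<in> {a..b}"
  shows "(f has_vector_derivative deriv_on a b f t) (at t within {a..b})"
  using assms unfolding deriv_on_def differentiable_on_def
  by (simp add: vector_derivative_works)

lemma deriv_on_eqI:
  assumes "a < b" "t \<in> {a..b}" "(f has_vector_derivative d) (at t within {a..b})"
  shows "deriv_on a b f t = d"
  using assms unfolding deriv_on_def by (intro vector_derivative_within_closed_interval)

lemma deriv_on_cong:
  assumes "\<And>s. s \<in> {a..b} \<Longrightarrow> f s = g s" "t \<in> {a..b}"
  shows "deriv_on a b f t = deriv_on a b g t"
  unfolding deriv_on_def using assms
  by (intro vector_derivative_cong_eq) (auto intro: always_eventually)

lemma Ck_on_cong:
  assumes "\<And>s. s \<in> {a..b} \<Longrightarrow> f s = g s"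
  shows "Ck_on k a b f \<longleftrightarrow> Ck_on k a b g"
  using assms
proof (induction k arbitrary: f g)
  case 0
  then show ?case by (simp only: Ck_on.simps cong: continuous_on_cong)
next
  case (Suc k)
  have "f differentiable_on {a..b} \<longleftrightarrow> g differentiable_on {a..b}"
    using Suc.prems by (metis differentiable_on_def differentiable_transform_within zero_less_one)
  moreover have "Ck_on k a b (deriv_on a b f) \<longleftrightarrow> Ck_on k a b (deriv_on a b g)"
    using Suc.prems by (intro Suc.IH deriv_on_cong) auto
  ultimately show ?case by simp
qed

text \<open>Any explicit derivative may replace \<open>deriv_on\<close>, by uniqueness of
  derivatives on a nondegenerate interval.\<close>

lemma Ck_on_SucI:
  assumes "a < b" "\<And>t. t \<in> {a..b} \<Longrightarrow> (f has_vector_derivative g t) (at t within {a..b})"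
    and "Ck_on k a b g"
  shows "Ck_on (Suc k) a b f"
proof -
  have "f differentiable_on {a..b}"
    using assms(2) unfolding differentiable_on_def by (blast intro: differentiableI_vector)
  moreover have "Ck_on k a b (deriv_on a b f) \<longleftrightarrow> Ck_on k a b g"
    using assms by (intro Ck_on_cong deriv_on_eqI) auto
  ultimately show ?thesis using assms by simp
qed

lemma Ck_on_SucD: "Ck_on (Suc k) a b f \<Longrightarrow> Ck_on k a b f"
  by (induction k arbitrary: f) (auto intro: differentiable_imp_continuous_on)

lemma Ck_on_add:
  assumes "a < b" "Ck_on k a b f" "Ck_on k a b g"
  shows "Ck_on k a b (\<lambda>t. f t + g t)"
  using assms
proof (induction k arbitrary: f g)
  case (Suc k)
  show ?case
  proof (rule Ck_on_SucI)
    show "((\<lambda>t. f t + g t) has_vector_derivative deriv_on a b f t + deriv_on a b g t)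
            (at t within {a..b})" if "t \<in> {a..b}" for t
      using Suc.prems that
      by (intro has_vector_derivative_add deriv_on_has_vector_derivative) auto
  qed (use Suc in auto)
qed (auto intro: continuous_intros)

lemma Ck_on_times_ident:
  assumes "a < b" "Ck_on k a b f"
  shows "Ck_on k a b (\<lambda>t. t * f t)"
  using assms
proof (induction k arbitrary: f)
  case (Suc k)
  show ?case
  proof (rule Ck_on_SucI)
    show "((\<lambda>t. t * f t) has_vector_derivative t * deriv_on a b f t + f t)
            (at t within {a..b})" if "t \<in> {a..b}" for t
      using deriv_on_has_vector_derivative[of f a b t] Suc.prems that
      by (auto intro!: derivative_eq_intros)
    show "Ck_on k a b (\<lambda>t. t * deriv_on a b f t + f t)"
      using Suc.prems by (intro Ck_on_add Suc.IH) (auto intro: Ck_on_SucD)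
  qed (use Suc in auto)
qed (auto intro: continuous_intros)

lemma Ck_on_x0:
  assumes "a < b" "Ck_on (m + k) a b x"
  shows "Ck_on m a b (x0 a b x k)"
  using assms(2)
proof (induction k arbitrary: m)
  case (Suc k)
  \<comment> \<open>Each step of \<open>x0\<close> costs one order of smoothness, so the induction
    hypothesis is used at \<open>Suc m\<close>.\<close>
  from Suc.prems have "Ck_on (Suc m) a b (x0 a b x k)"
    using Suc.IH[of "Suc m"] by simp
  then show ?case
    using assms(1) by (simp add: Ck_on_times_ident)
qed simp

lemma continuous_on_x0:
  assumes "a < b" "Ck_on n a b x" "k \<le> n"
  shows "continuous_on {a..b} (x0 a b x k)"
proof -
  have "Ck_on (n - k) a b (x0 a b x k)" using assms by (intro Ck_on_x0) auto
  then show ?thesis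
    by (cases "n - k") (auto intro: differentiable_imp_continuous_on)
qed

lemma has_vector_derivative_x0:
  assumes "0 < a" "Ck_on n a b x" "k < n" "t \<in> {a<..<b}"
  shows "(x0 a b x k has_vector_derivative x0 a b x (Suc k) t / t) (at t)"
proof -
  have "Ck_on (Suc (n - Suc k)) a b (x0 a b x k)" using assms by (intro Ck_on_x0) auto
  then have "(x0 a b x k has_vector_derivative deriv_on a b (x0 a b x k) t) (at t within {a..b})"
    using assms by (intro deriv_on_has_vector_derivative) auto
  then show ?thesis
    using assms by (simp add: at_within_Icc_at)
qed

text \<open>Both recursions differentiate the same function at each step. Integration by parts can
  thus run on \<open>x0\<close> alone, with \<open>x1\<close> entering only through the final
  bound.\<close>

lemma x1_eq_x0:
  assumes "0 < a" "t \<in> {a..b}"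
  shows "x1 a b x k t = x0 a b x (Suc k) t / t"
  using assms(2)
proof (induction k arbitrary: t)
  case (Suc k)
  have "x1 a b x (Suc k) t = deriv_on a b (x0 a b x (Suc k)) t"
    unfolding x1.simps using Suc assms(1) by (intro deriv_on_cong) auto
  then show ?case using Suc.prems assms(1) by simp
qed (use assms in auto)

text \<open>\<open>GREATEST\<close> is informative only when a maximum is attained; continuity on
  the compact \<open>{t..b}\<close> provides one.\<close>

lemma abs_x1_le_L_max:
  assumes "0 < a" "a < b" "Ck_on (Suc n) a b x" "t \<in> {a..b}" "s \<in> {t..b}"
  shows "\<bar>x1 a b x n s\<bar> \<le> L_max a b x n t"
proof -
  have "continuous_on {t..b} (\<lambda>s. \<bar>x0 a b x (Suc n) s / s\<bar>)"
    using assms continuous_on_subset[OF continuous_on_x0[of a b "Suc n" x "Suc n"], of "{t..b}"]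
    by (intro continuous_intros) auto
  then have "continuous_on {t..b} (\<lambda>s. \<bar>x1 a b x n s\<bar>)"
    using assms by (subst continuous_on_cong[OF refl x1_eq_x0[THEN arg_cong[where f = abs]]]) auto
  then obtain m where m: "m \<in> {t..b}" "\<And>s. s \<in> {t..b} \<Longrightarrow> \<bar>x1 a b x n s\<bar> \<le> \<bar>x1 a b x n m\<bar>"
    using continuous_attains_sup[of "{t..b}" "\<lambda>s. \<bar>x1 a b x n s\<bar>"] assms by auto
  have "L_max a b x n t = \<bar>x1 a b x n m\<bar>"
    unfolding L_max_def using m by (intro Greatest_equality) auto
  then show ?thesis using m assms by simp
qed

section \<open>Gamma quotients and the coefficients of the approximation\<close>

text \<open>The rising factorial covers both branches: it is the product for integer \<alpha>, and
  otherwise \<open>- \<alpha> - real i\<close> is not a pole of Gamma.\<close>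

lemma Gamma_quot_A_eq:
  assumes "n \<le> p + i"
  shows "Gamma_quot_A \<alpha> n i p = pochhammer (- \<alpha> - real i) (p + i - n)"
proof (cases "\<alpha> \<in> \<int>")
  case False
  then have "- \<alpha> - real i \<notin> \<int>"
    by (metis Ints_add Ints_minus Ints_of_nat diff_add_cancel minus_minus)
  then have "- \<alpha> - real i \<notin> \<int>\<^sub>\<le>\<^sub>0" using nonpos_Ints_Int by blast
  moreover have "- \<alpha> - real i + real (p + i - n) = real p - \<alpha> - real n"
    using assms by simp
  ultimately have "pochhammer (- \<alpha> - real i) (p + i - n) =
      Gamma (real p - \<alpha> - real n) / Gamma (- \<alpha> - real i)"
    by (metis pochhammer_Gamma)
  then show ?thesis
    using False by (simp add: Gamma_quot_A_def)
qed (simp add: Gamma_quot_A_def pochhammer_prod lessThan_atLeast0)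

lemma Gamma_quot_B_eq:
  assumes "n < p"
  shows "Gamma_quot_B \<alpha> n p = pochhammer (1 - \<alpha>) (p - n - 1)"
proof (cases "\<alpha> \<in> \<int>")
  case True
  have "(\<Prod>j=1..p - n - 1. real j - \<alpha>) = (\<Prod>j<p - n - 1. 1 - \<alpha> + real j)"
    by (rule prod.reindex_bij_witness[of _ Suc "\<lambda>j. j - 1"]) auto
  then show ?thesis using True
    by (simp add: Gamma_quot_B_def pochhammer_prod lessThan_atLeast0)
next
  case False
  then have "1 - \<alpha> \<notin> \<int>"
    by (metis Ints_1 Ints_diff diff_diff_eq2 add_diff_cancel_left')
  then have "1 - \<alpha> \<notin> \<int>\<^sub>\<le>\<^sub>0" using nonpos_Ints_Int by blast
  moreover have "1 - \<alpha> + real (p - n - 1) = real p - \<alpha> - real n"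
    using assms by (simp add: of_nat_diff)
  ultimately have "pochhammer (1 - \<alpha>) (p - n - 1) =
      Gamma (real p - \<alpha> - real n) / Gamma (1 - \<alpha>)"
    by (metis pochhammer_Gamma)
  then show ?thesis
    using False by (simp add: Gamma_quot_B_def)
qed

text \<open>With \<open>q = p + i - n\<close> the bracket, its 1 being the term
  \<open>q = 0\<close>, is the Taylor polynomial of \<open>(1 - z) powr (\<alpha> + real i)\<close>
  at \<open>z = 1\<close>, where the power itself is 0. This is the boundary value left by
  integration by parts.\<close>

lemma A_coeff_eq:
  assumes "0 < \<alpha>" "n < N" "i \<le> n"
  shows "A_coeff \<alpha> n N i = (-1) ^ i / Gamma (\<alpha> + real i + 1) *
     (- binomial_remainder (\<alpha> + real i) (N - n + i) 1)"
proof -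
  let ?f = "\<lambda>q. pochhammer (- \<alpha> - real i) q / fact q"
  have "(\<Sum>p=n - i + 1..N. Gamma_quot_A \<alpha> n i p / fact (p + i - n)) = (\<Sum>q\<in>{1..N - n + i}. ?f q)"
    using assms
    by (intro sum.reindex_bij_witness[of _ "\<lambda>q. q + n - i" "\<lambda>p. p + i - n"])
       (auto simp: Gamma_quot_A_eq)
  also have "1 + \<dots> = (\<Sum>q\<le>N - n + i. ?f q)"
    by (simp add: atMost_atLeast0 sum.atLeast_Suc_atMost)
  also have "\<dots> = (\<Sum>q\<le>N - n + i. ((\<alpha> + real i) gchoose q) * (- 1) ^ q)"
    by (intro sum.cong) (auto simp: gbinomial_pochhammer mult_ac simp flip: power_mult_distrib)
  finally show ?thesis
    by (simp add: A_coeff_def binomial_remainder_def)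
qed

text \<open>The factor \<open>real (p - n)\<close> comes from \<open>W\<close> and turns
  \<open>fact (p - n)\<close> into \<open>fact (p - n - 1)\<close>, leaving a Taylor coefficient of
  \<open>(1 - z) powr (\<alpha> - 1)\<close>.\<close>

lemma B_coeff_eq:
  assumes "n < p"
  shows "B_coeff \<alpha> n p * real (p - n) =
    ((\<alpha> - 1) gchoose (p - n - 1)) * (- 1) ^ (p - n - 1) / Gamma \<alpha>"
proof -
  obtain k where k: "p - n = Suc k" using assms by (cases "p - n") auto
  have "(fact (Suc k) :: real) = real (Suc k) * fact k" by simp
  then show ?thesis
    using assms by (simp add: B_coeff_def Gamma_quot_B_eq k gbinomial_pochhammer mult_ac
      del: fact_Suc of_nat_Suc flip: power_mult_distrib)
qed

section \<open>Integration by parts and the integral form of the error\<close>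

lemma integral_binomial_remainder_by_parts:
  fixes f g :: "real \<Rightarrow> real"
  assumes "0 < t" "t < b" "0 < c"
    and f: "continuous_on {t..b} f" and g: "continuous_on {t..b} g"
    and deriv: "\<And>s. s \<in> {t<..<b} \<Longrightarrow> (f has_vector_derivative g s / s) (at s)"
  shows "integral {t..b} (\<lambda>s. binomial_remainder (c - 1) M (ln (b / s) / ln (b / t)) * (f s / s)) =
    ln (b / t) / c * (- binomial_remainder c (Suc M) 1 * f t -
      integral {t..b} (\<lambda>s. binomial_remainder c (Suc M) (ln (b / s) / ln (b / t)) * (g s / s)))"
proof -
  define T where "T = ln (b / t)"
  have T: "T > 0" using assms by (simp add: T_def)
  define z where "z = (\<lambda>s. ln (b / s) / T)"
  \<comment> \<open>\<open>z\<close> has derivative \<open>- 1 / (s * T)\<close>, so the factor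
    \<open>T / c\<close> makes \<open>R\<close> an antiderivative of the kernel divided by
    \<open>s\<close>.\<close>
  define R where "R = (\<lambda>s. T / c * binomial_remainder c (Suc M) (z s))"
  have z_le: "z s \<le> 1" if "s \<in> {t..b}" for s
    using that assms T by (auto simp: z_def T_def frac_le)
  have z_less: "z s < 1" if "s \<in> {t<..<b}" for s
  proof -
    have "b / s < b / t" using that assms by (auto simp: frac_less2)
    then show ?thesis using that assms T by (auto simp: z_def T_def)
  qed
  have contz: "continuous_on {t..b} z"
    unfolding z_def using assms T by (intro continuous_intros) auto
  have contR: "continuous_on {t..b} R"
    unfolding R_def
    by (intro continuous_intros continuous_on_compose2[OF continuous_on_binomial_remainder contz])
       (use z_le assms in auto)
  have derivR: "(R has_vector_derivative binomial_remainder (c - 1) M (z s) / s) (at s)"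
    if "s \<in> {t<..<b}" for s
  proof -
    have "(z has_real_derivative - 1 / (s * T)) (at s)"
      unfolding z_def using that assms T
      by (auto intro!: derivative_eq_intros simp: field_simps)
    from DERIV_chain2[OF has_real_derivative_binomial_remainder[OF z_less[OF that]] this]
    have "(R has_real_derivative
        T / c * ((- c * binomial_remainder (c - 1) M (z s)) * (- 1 / (s * T)))) (at s)"
      unfolding R_def by (intro DERIV_cmult)
    also have "T / c * ((- c * binomial_remainder (c - 1) M (z s)) * (- 1 / (s * T))) =
        binomial_remainder (c - 1) M (z s) / s"
      using T assms by simp
    finally show ?thesis by (simp add: has_real_derivative_iff_has_vector_derivative)
  qed
  define J where "J = integral {t..b} (\<lambda>s. R s * (g s / s))"
  have "(\<lambda>s. R s * (g s / s)) integrable_on {t..b}"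
    using assms by (intro integrable_continuous_real continuous_intros contR) auto
  then have "((\<lambda>s. R s * (g s / s)) has_integral J) {t..b}"
    unfolding J_def by (rule integrable_integral)
  \<comment> \<open>\<open>J\<close> in the shape required by the rule for integration by
    parts.\<close>
  then have "((\<lambda>s. R s * (g s / s)) has_integral R b * f b - R t * f t - (R b * f b - R t * f t - J)) {t..b}"
    by simp
  then have "((\<lambda>s. binomial_remainder (c - 1) M (z s) / s * f s) has_integral
      (R b * f b - R t * f t - J)) {t..b}"
    \<comment> \<open>The interior version is used because for \<open>c < 1\<close> the kernel may
      be singular at \<open>s = t\<close>, where only \<open>R\<close> is continuous.\<close>
    using assms(2)
    by (intro integration_by_parts_interior[OF bounded_bilinear_mult _ contR f derivR deriv]) auto
  then have "integral {t..b} (\<lambda>s. binomial_remainder (c - 1) M (z s) * (f s / s)) =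
      R b * f b - R t * f t - J"
    by (simp add: integral_unique)
  moreover have "R b = 0" using assms by (simp add: R_def z_def)
  moreover have "R t = T / c * binomial_remainder c (Suc M) 1"
    using assms T by (simp add: R_def z_def T_def)
  moreover have "J = T / c * integral {t..b} (\<lambda>s. binomial_remainder c (Suc M) (z s) * (g s / s))"
    unfolding J_def R_def mult.assoc by (rule integral_mult_right)
  ultimately show ?thesis
    unfolding z_def T_def by (simp add: right_diff_distrib)
qed

text \<open>The singularity for \<alpha> < 1 is harmless: the nonnegative kernel has an
  antiderivative continuous at \<open>t\<close>, and \<open>f\<close> is bounded. Absolute
  integrability permits passing from the Lebesgue integral to \<open>integral\<close>.\<close>

lemma absolutely_integrable_Hadamard_kernel:
  fixes f :: "real \<Rightarrow> real"
  assumes "0 < t" "t < b" "0 < \<alpha>" and f: "continuous_on {t..b} f"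
  shows "(\<lambda>s. ln (s / t) powr (\<alpha> - 1) * (f s / s)) absolutely_integrable_on {t..b}"
proof -
  have "((\<lambda>s. ln (s / t) powr (\<alpha> - 1) / s) has_integral
      ln (b / t) powr \<alpha> / \<alpha> - ln (t / t) powr \<alpha> / \<alpha>) {t..b}"
  proof (rule fundamental_theorem_of_calculus_interior)
    show "continuous_on {t..b} (\<lambda>s. ln (s / t) powr \<alpha> / \<alpha>)"
      using assms by (intro continuous_intros continuous_on_powr') auto
    show "((\<lambda>s. ln (s / t) powr \<alpha> / \<alpha>) has_vector_derivative ln (s / t) powr (\<alpha> - 1) / s) (at s)"
      if "s \<in> {t<..<b}" for s
      unfolding has_real_derivative_iff_has_vector_derivative[symmetric]
      using assms that by (auto intro!: derivative_eq_intros simp: field_simps)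
  qed (use assms in auto)
  then have "(\<lambda>s. ln (s / t) powr (\<alpha> - 1) / s) absolutely_integrable_on {t..b}"
    using assms by (intro nonnegative_absolutely_integrable_1) (auto simp: integrable_on_def)
  then have "(\<lambda>s. f s * (ln (s / t) powr (\<alpha> - 1) / s)) absolutely_integrable_on {t..b}"
    using f by (intro absolutely_integrable_bounded_measurable_product_real
        continuous_imp_measurable_on_sets_lebesgue compact_imp_bounded compact_continuous_image) auto
  then show ?thesis by (simp add: mult_ac)
qed

lemma Hadamard_integral_minus_moments:
  assumes "0 < t" "t < b" "0 < \<alpha>" "n < N" and x: "continuous_on {t..b} x"
  shows "right_Hadamard_integral b \<alpha> x t -
      (\<Sum>p=n + 1..N. B_coeff \<alpha> n p * ln (b / t) powr (\<alpha> + real n - real p) * W b x n p t) =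
    ln (b / t) powr (\<alpha> - 1) / Gamma \<alpha> *
      integral {t..b} (\<lambda>s. binomial_remainder (\<alpha> - 1) (N - n - 1) (ln (b / s) / ln (b / t)) * (x s / s))"
proof -
  define T where "T = ln (b / t)"
  have T: "T > 0" using assms by (simp add: T_def)
  define h where "h = (\<lambda>s. ln (s / t) powr (\<alpha> - 1) * (x s / s))"
  define w where "w = (\<lambda>q s. ln (b / s) ^ q * (x s / s))"
  \<comment> \<open>The Taylor coefficient of degree \<open>q\<close>, scaled by
    \<open>T powr (\<alpha> - 1)\<close> from the kernel and by \<open>T powr (- real q)\<close>
    from the power of \<open>z\<close>.\<close>
  define d where "d = (\<lambda>q. T powr (\<alpha> - 1 - real q) * (((\<alpha> - 1) gchoose q) * (- 1) ^ q))"
  have h: "h absolutely_integrable_on {t..b}"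
    unfolding h_def using assms by (intro absolutely_integrable_Hadamard_kernel)
  have "continuous_on {t..b} (w q)" for q
    unfolding w_def using assms by (intro continuous_intros) auto
  then have w: "w q absolutely_integrable_on {t..b}" for q
    by (rule absolutely_integrable_continuous_real)
  note int = set_lebesgue_integral_eq_integral[OF h] set_lebesgue_integral_eq_integral[OF w]
  have W: "W b x n p t = real (p - n) * integral {t..b} (w (p - n - 1))" for p
  proof -
    have "W b x n p t = (LINT s:{t..b}|lebesgue. real (p - n) * w (p - n - 1) s)"
      by (simp add: W_def w_def mult.assoc)
    then show ?thesis using int by simp
  qed
  have kernel: "T powr (\<alpha> - 1) *
      (binomial_remainder (\<alpha> - 1) (N - n - 1) (ln (b / s) / T) * (x s / s)) =
      h s - (\<Sum>q\<le>N - n - 1. d q * w q s)" if "s \<in> {t..b}" for s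
  proof -
    \<comment> \<open>This identifies the kernel with a multiple of
      \<open>(1 - z) powr (\<alpha> - 1)\<close>. At \<open>s = t\<close> both are 0, since
      \<open>0 powr y = 0\<close> for every \<open>y\<close>.\<close>
    have "ln (s / t) = T * (1 - ln (b / s) / T)"
      using T that assms by (simp add: T_def ln_div field_simps)
    moreover have "ln (b / s) \<le> T"
      using that assms by (auto simp: T_def frac_le)
    ultimately have "ln (s / t) powr (\<alpha> - 1) = T powr (\<alpha> - 1) * (1 - ln (b / s) / T) powr (\<alpha> - 1)"
      using T by (simp add: powr_mult)
    moreover have "T powr (\<alpha> - 1) * (((\<alpha> - 1) gchoose q) * (- (ln (b / s) / T)) ^ q) = d q * ln (b / s) ^ q" for q
      using T unfolding d_def power_minus[of "ln (b / s) / T"] power_divide powr_diff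
      by (simp add: powr_realpow)
    ultimately show ?thesis
      unfolding binomial_remainder_def h_def w_def
      by (simp add: algebra_simps sum_distrib_left sum_distrib_right)
  qed
  have "T powr (\<alpha> - 1) *
      integral {t..b} (\<lambda>s. binomial_remainder (\<alpha> - 1) (N - n - 1) (ln (b / s) / T) * (x s / s)) =
      integral {t..b} (\<lambda>s. h s - (\<Sum>q\<le>N - n - 1. d q * w q s))"
    by (subst integral_mult_right[symmetric], rule integral_cong) (rule kernel)
  also have "\<dots> = integral {t..b} h - (\<Sum>q\<le>N - n - 1. d q * integral {t..b} (w q))"
  proof -
    have "(\<lambda>s. d q * w q s) integrable_on {t..b}" for q
      using integrable_on_cmult_left[OF int(3), of "d q" q] by simp
    then show ?thesis
      using int by (subst integral_diff) (auto intro!: integrable_sum simp: integral_sum)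
  qed
  finally have "T powr (\<alpha> - 1) / Gamma \<alpha> *
      integral {t..b} (\<lambda>s. binomial_remainder (\<alpha> - 1) (N - n - 1) (ln (b / s) / T) * (x s / s)) =
      1 / Gamma \<alpha> * integral {t..b} h - (\<Sum>q\<le>N - n - 1. d q / Gamma \<alpha> * integral {t..b} (w q))"
    by (simp add: diff_divide_distrib sum_divide_distrib)
  also have "1 / Gamma \<alpha> * integral {t..b} h = right_Hadamard_integral b \<alpha> x t"
    using int by (simp add: right_Hadamard_integral_def h_def)
  also have "(\<Sum>q\<le>N - n - 1. d q / Gamma \<alpha> * integral {t..b} (w q)) =
      (\<Sum>p=n + 1..N. B_coeff \<alpha> n p * T powr (\<alpha> + real n - real p) * W b x n p t)"
  proof (rule sum.reindex_bij_witness[of _ "\<lambda>p. p - n - 1" "\<lambda>q. q + n + 1"])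
    fix q
    have "B_coeff \<alpha> n (q + n + 1) * T powr (\<alpha> + real n - real (q + n + 1)) * W b x n (q + n + 1) t =
      (B_coeff \<alpha> n (q + n + 1) * real (q + n + 1 - n)) * T powr (\<alpha> - 1 - real q) * integral {t..b} (w q)"
      unfolding W by (simp add: algebra_simps)
    also have "\<dots> = d q / Gamma \<alpha> * integral {t..b} (w q)"
      by (subst B_coeff_eq) (simp_all add: d_def)
    finally show "B_coeff \<alpha> n (q + n + 1) * T powr (\<alpha> + real n - real (q + n + 1)) * W b x n (q + n + 1) t
      = d q / Gamma \<alpha> * integral {t..b} (w q)" .
  qed (use assms in auto)
  finally show ?thesis by (simp add: T_def)
qed

lemma E_tr_eq_integral:
  assumes "0 < \<alpha>" "0 < a" "Ck_on (Suc n) a b x" "n < N" and t: "t \<in> {a<..<b}"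
  shows "E_tr a b \<alpha> n N x t =
    (- 1) ^ Suc n * (ln (b / t) powr (\<alpha> + real n) / Gamma (\<alpha> + real n + 1)) *
      integral {t..b} (\<lambda>s. binomial_remainder (\<alpha> + real n) N (ln (b / s) / ln (b / t)) *
        (x0 a b x (Suc n) s / s))"
proof -
  define T where "T = ln (b / t)"
  have T: "T > 0" using assms by (simp add: T_def)
  \<comment> \<open>The integral after \<open>j\<close> integrations by parts. \<open>J 0\<close>
    comes from the moment identity; \<open>J (Suc n)\<close> has exponent
    \<open>\<alpha> + real n\<close> and, as \<open>n < N\<close>, degree \<open>N\<close>.\<close>
  define J where "J = (\<lambda>j. integral {t..b} (\<lambda>s.
    binomial_remainder (\<alpha> + real j - 1) (N - n - 1 + j) (ln (b / s) / T) * (x0 a b x j s / s)))"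
  have cont: "continuous_on {t..b} (x0 a b x k)" if "k \<le> Suc n" for k
    using continuous_on_subset[OF continuous_on_x0[of a b "Suc n" x k], of "{t..b}"] assms that by auto
  have step: "J j = T / (\<alpha> + real j) *
      (- binomial_remainder (\<alpha> + real j) (N - n + j) 1 * x0 a b x j t - J (Suc j))" if "j \<le> n" for j
  proof -
    have "Suc (N - n - 1 + j) = N - n + j" "N - n - 1 + Suc j = N - n + j"
      using assms by auto
    then show ?thesis
      using integral_binomial_remainder_by_parts[of t b "\<alpha> + real j" "x0 a b x j" "x0 a b x (Suc j)"
          "N - n - 1 + j"] that assms has_vector_derivative_x0[of a "Suc n" b x j] cont[of j] cont[of "Suc j"]
      unfolding J_def T_def by (simp add: add.assoc del: x0.simps)
  qed
  \<comment> \<open>Each step splits off one term with \<open>A_coeff\<close> and flips the sign of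
    the rest; the recurrence of Gamma absorbs the factor
    \<open>1 / (\<alpha> + real m)\<close>.\<close>
  have telescope: "T powr (\<alpha> - 1) / Gamma \<alpha> * J 0 =
      (\<Sum>i<m. A_coeff \<alpha> n N i * T powr (\<alpha> + real i) * x0 a b x i t) +
      (- 1) ^ m * (T powr (\<alpha> + real m - 1) / Gamma (\<alpha> + real m)) * J m" if "m \<le> Suc n" for m
    using that
  proof (induction m)
    case (Suc m)
    have "Gamma (\<alpha> + real m + 1) = (\<alpha> + real m) * Gamma (\<alpha> + real m)"
      using assms by (intro Gamma_plus1) (auto elim!: nonpos_Ints_cases)
    moreover have "Gamma (\<alpha> + real m) > 0" using assms by simp
    moreover have "T powr (\<alpha> + real m) = T powr (\<alpha> + real m - 1) * T"
      using T by (simp add: powr_diff)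
    ultimately have coeff: "T powr (\<alpha> + real m - 1) / Gamma (\<alpha> + real m) * (T / (\<alpha> + real m)) =
        T powr (\<alpha> + real m) / Gamma (\<alpha> + real m + 1)"
      by simp
    have "(- 1) ^ m * (T powr (\<alpha> + real m - 1) / Gamma (\<alpha> + real m)) * J m =
      (- 1) ^ m * (T powr (\<alpha> + real m - 1) / Gamma (\<alpha> + real m) * (T / (\<alpha> + real m))) *
      (- binomial_remainder (\<alpha> + real m) (N - n + m) 1 * x0 a b x m t - J (Suc m))"
      using Suc.prems by (subst step) simp_all
    also have "\<dots> = A_coeff \<alpha> n N m * T powr (\<alpha> + real m) * x0 a b x m t +
      (- 1) ^ Suc m * (T powr (\<alpha> + real m) / Gamma (\<alpha> + real m + 1)) * J (Suc m)"
      unfolding coeff using Suc.prems assms by (subst A_coeff_eq) (simp_all add: algebra_simps)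
    finally show ?case using Suc by (simp add: add_ac)
  qed simp
  have "E_tr a b \<alpha> n N x t = T powr (\<alpha> - 1) / Gamma \<alpha> * J 0 -
      (\<Sum>i<Suc n. A_coeff \<alpha> n N i * T powr (\<alpha> + real i) * x0 a b x i t)"
    using Hadamard_integral_minus_moments[of t b \<alpha> n N x] cont[of 0] assms
    unfolding E_tr_def Hadamard_approx_def J_def T_def
    by (simp add: atLeast0AtMost lessThan_Suc_atMost del: sum.lessThan_Suc)
  also have "\<dots> = (- 1) ^ Suc n * (T powr (\<alpha> + real n) / Gamma (\<alpha> + real n + 1)) * J (Suc n)"
    unfolding telescope[OF order.refl] by (simp add: add_ac)
  finally show ?thesis
    using assms by (simp add: J_def T_def add_ac del: x0.simps)
qed

section \<open>The estimate of the error integral\<close>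

theorem mainTheorem3:
  fixes \<alpha> a b :: real and n N :: nat and x :: "real \<Rightarrow> real"
  assumes "\<alpha> > 0" and "n \<ge> 1" and "0 < a" and "a < b"
    and "Ck_on (n + 1) a b x" and "N \<ge> n + 1"
  shows "\<forall>t\<in>{a<..<b}.
    \<bar>E_tr a b \<alpha> n N x t\<bar>
      \<le> L_max a b x n t *
        (exp ((\<alpha> + real n)\<^sup>2 + \<alpha> + real n) /
          (Gamma (\<alpha> + real n + 1) * (\<alpha> + real n) * real N powr (\<alpha> + real n))) *
        ln (b / t) powr (\<alpha> + real n) * (b - t)"
proof
  fix t assume t: "t \<in> {a<..<b}"
  define c where "c = \<alpha> + real n"
  have c: "c > 0" using assms by (simp add: c_def)
  have Ck: "Ck_on (Suc n) a b x" using assms by simp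
  define T where "T = ln (b / t)"
  have T: "T > 0" using assms t by (simp add: T_def)
  define L where "L = L_max a b x n t"
  have L: "\<bar>x0 a b x (Suc n) s / s\<bar> \<le> L" if "s \<in> {t..b}" for s
    using abs_x1_le_L_max[OF assms(3,4) Ck, of t s] x1_eq_x0[of a s b x n] that t assms
    by (simp add: L_def)
  define D where "D = exp (c\<^sup>2 + c) / (c * real N powr c)"
  have D: "D > 0" using c assms by (simp add: D_def)
  let ?g = "\<lambda>s. binomial_remainder c N (ln (b / s) / T) * (x0 a b x (Suc n) s / s)"
  have "?g integrable_on {t..b}"
  proof (rule integrable_continuous_real)
    have "continuous_on {t..b} (\<lambda>s. ln (b / s) / T)"
      using t assms T by (intro continuous_intros) auto
    moreover have "ln (b / s) / T \<le> 1" if "s \<in> {t..b}" for s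
      using that t assms T by (auto simp: T_def frac_le)
    ultimately have "continuous_on {t..b} (\<lambda>s. binomial_remainder c N (ln (b / s) / T))"
      by (intro continuous_on_compose2[OF continuous_on_binomial_remainder[OF c]]) auto
    moreover have "continuous_on {t..b} (x0 a b x (Suc n))"
      using continuous_on_subset[OF continuous_on_x0[OF assms(4) Ck order.refl]] t by auto
    ultimately show "continuous_on {t..b} ?g"
      using t assms by (intro continuous_on_mult continuous_on_divide continuous_on_id) auto
  qed
  then have "(?g has_integral integral {t..b} ?g) (cbox t b)"
    by (simp add: integrable_integral)
  \<comment> \<open>The point \<open>t\<close> is left out: there \<open>z = 1\<close>, outside the
    range of the remainder bound. One point does not affect the integral.\<close>
  moreover have "norm (?g s) \<le> D * L" if "s \<in> cbox t b - {t}" for s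
  proof -
    have s: "t < s" "s \<le> b" using that by auto
    then have "b / s < b / t" using t assms by (simp add: frac_less2)
    then have "ln (b / s) / T < 1" "0 \<le> ln (b / s) / T"
      using s t assms T by (auto simp: T_def)
    then have "\<bar>binomial_remainder c N (ln (b / s) / T)\<bar> \<le> D"
      unfolding D_def using c assms by (intro binomial_remainder_bound) auto
    then show ?thesis
      unfolding real_norm_def abs_mult using L[of s] s D by (intro mult_mono) auto
  qed
  moreover have "0 \<le> L" using L[of b] t by (meson abs_ge_zero atLeastAtMost_iff
        greaterThanLessThan_iff order.refl order.strict_implies_order order_trans)
  ultimately have "\<bar>integral {t..b} ?g\<bar> \<le> D * L * (b - t)"
    using has_integral_bound_spike_finite[of "D * L" "{t}" ?g "integral {t..b} ?g" t b] D t by simp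
  moreover have "\<bar>E_tr a b \<alpha> n N x t\<bar> = T powr c / Gamma (c + 1) * \<bar>integral {t..b} ?g\<bar>"
    using E_tr_eq_integral[OF assms(1,3) Ck _ t, of N] assms c
    by (simp add: c_def T_def abs_mult power_abs del: x0.simps)
  ultimately have "\<bar>E_tr a b \<alpha> n N x t\<bar> \<le> T powr c / Gamma (c + 1) * (D * L * (b - t))"
    using c by (simp add: divide_right_mono mult_left_mono)
  also have "\<dots> = L * (exp (c\<^sup>2 + c) / (Gamma (c + 1) * c * real N powr c)) * T powr c * (b - t)"
    by (simp add: D_def mult_ac)
  finally show "\<bar>E_tr a b \<alpha> n N x t\<bar> \<le> L_max a b x n t *
        (exp ((\<alpha> + real n)\<^sup>2 + \<alpha> + real n) /
          (Gamma (\<alpha> + real n + 1) * (\<alpha> + real n) * real N powr (\<alpha> + real n))) *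
        ln (b / t) powr (\<alpha> + real n) * (b - t)"
    by (simp add: c_def L_def T_def add.assoc)
qed

end
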